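(* Let $0<\gamma<1$ and $0<\alpha<1$. The magnitudes of the coefficients $t_n=t_n(\alpha,\gamma)$ are bounded above through the formula $$|t_n|<(1-\alpha)^{\gamma}\frac{\gamma^{-n}}{\Gamma(\gamma)}\,\mathrm{Li}_{-n-\gamma+1}(\alpha),$$ and are bounded below through the formula $$|t_n|>(1-\alpha)^{\gamma}\frac{\gamma^{-n}}{\Gamma(\gamma)}\left[\mathrm{Li}_{-n-\gamma+1}(\alpha)-(1-\gamma)\,\mathrm{Li}_{-n-\gamma+2}(\alpha)\right].$$
   Context: For $n\ge0$, $t_n(\alpha,\gamma):=(-1)^n\gamma^{-n}\sum_{i=0}^nS(n,i)(\gamma)_i\left(\frac{\alpha}{1-\alpha}\right)^i$, where $S(n,i)$ is the Stirling number of the second kind (with $S(0,0)=1$) and $(\gamma)_i=\gamma(\gamma+1)\cdots(\gamma+i-1)$ is the Pochhammer symbol. $\mathrm{Li}_s(z)=\sum_{l\ge1}z^l/l^s$ for $|z|<1$ is the polylogarithm, and $\Gamma$ is the Gamma function.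
   Formalization: The upper bound is stated only for n ≥ 1, since at n = 0 it is false (t_0 = 1, while for γ = 1/2, α = 0.01 the right-hand side is about 0.0057); the lower bound is stated for all n ≥ 0. *)

theory Defs
  imports "HOL-Analysis.Gamma_Function" "HOL-Combinatorics.Stirling"
begin

definition t_coeff :: "nat \<Rightarrow> real \<Rightarrow> real \<Rightarrow> real" where
  "t_coeff n \<alpha> \<gamma> =
     (-1) ^ n * \<gamma> powi (- int n) *
     (\<Sum>i=0..n. real (Stirling n i) * pochhammer \<gamma> i * (\<alpha> / (1 - \<alpha>)) ^ i)"

(* The library's suminf starts at 0, so the index is shifted by one. The series converges
   for norm z < 1; elsewhere no analytic continuation is intended. *)
definition polylog :: "'a \<Rightarrow> 'a \<Rightarrow> 'a :: {real_normed_field, ln}" where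
  "polylog s z = (\<Sum>l. z ^ Suc l / of_nat (Suc l) powr s)"

end

theory Submission
  imports Defs "HOL-Analysis.Generalised_Binomial_Theorem"
begin

text \<open>
  Expanding the powers of \<open>l\<close> in falling factorials and summing the binomial series of
  \<open>(1 - \<alpha>) powr - (\<gamma> + i)\<close> gives
  \<open>\<bar>t\<^sub>n\<bar> = (1 - \<alpha>)\<^sup>\<gamma> \<gamma>\<^sup>-\<^sup>n (\<Sum>l. l\<^sup>n (\<gamma>)\<^sub>l / l! \<alpha>\<^sup>l)\<close>,
  where \<open>(\<gamma>)\<^sub>l / l! = \<Gamma>(l + \<gamma>) / (\<Gamma>(\<gamma>) \<Gamma>(l + 1))\<close>. Both estimates then hold termwise,
  because log-convexity of the Gamma function squeezes \<open>\<Gamma>(l + \<gamma>) / \<Gamma>(l + 1)\<close> between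
  \<open>l\<^sup>\<gamma>\<^sup>-\<^sup>1 - (1 - \<gamma>) l\<^sup>\<gamma>\<^sup>-\<^sup>2\<close> and \<open>l\<^sup>\<gamma>\<^sup>-\<^sup>1\<close>.
\<close>

section \<open>Stirling numbers and power moments of the binomial series\<close>

lemma power_eq_sum_Stirling_binomial:
  "l ^ n = (\<Sum>i\<le>n. Stirling n i * (fact i * (l choose i)))"
proof (induction n)
  case (Suc n)
  \<comment> \<open>\<open>b i\<close> is the falling factorial of \<open>l\<close> of length
    \<open>i\<close>. Writing \<open>l = i + (l - i)\<close> splits \<open>l * b i\<close> in the
    pattern of the Stirling recurrence.\<close>
  define b where "b i = fact i * (l choose i)" for i
  have b_Suc: "l * b i = i * b i + b (Suc i)" for i
  proof (cases "i \<le> l")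
    case True
    have "Suc i * (l choose Suc i) = (l - i) * (l choose i)"
      using binomial_absorption[of i l] binomial_absorb_comp[of l i] by simp
    then have "b (Suc i) = fact i * ((l - i) * (l choose i))"
      unfolding b_def fact_Suc of_nat_id by (metis mult.assoc mult.commute)
    then have "b (Suc i) = (l - i) * b i"
      by (simp add: b_def)
    then show ?thesis
      using True by (metis add_mult_distrib le_add_diff_inverse)
  qed (simp add: b_def binomial_eq_0)
  have "l ^ Suc n = (\<Sum>i\<le>n. Stirling n i * (l * b i))"
    using Suc by (simp add: b_def sum_distrib_left mult_ac)
  also have "\<dots> = (\<Sum>i\<le>n. i * Stirling n i * b i) + (\<Sum>i\<le>n. Stirling n i * b (Suc i))"
    by (simp add: b_Suc sum.distrib algebra_simps)
  \<comment> \<open>The added term vanishes since \<open>Stirling n (Suc n) = 0\<close>. The term at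
    0 vanishes through its factor \<open>i\<close>, so after the index shift both sums run over the
    same range.\<close>
  also have "(\<Sum>i\<le>n. i * Stirling n i * b i) = (\<Sum>i\<le>Suc n. i * Stirling n i * b i)"
    by simp
  also have "\<dots> = (\<Sum>i\<le>n. Suc i * Stirling n (Suc i) * b (Suc i))"
    by (subst sum.atMost_Suc_shift) simp
  also have "\<dots> + (\<Sum>i\<le>n. Stirling n i * b (Suc i)) = (\<Sum>i\<le>n. Stirling (Suc n) (Suc i) * b (Suc i))"
    by (simp add: sum.distrib [symmetric] algebra_simps)
  also have "\<dots> = (\<Sum>i\<le>Suc n. Stirling (Suc n) i * b i)"
    by (subst sum.atMost_Suc_shift) simp
  finally show ?case
    by (simp add: b_def)
qed simp

lemma pochhammer_series_sums:
  fixes a z :: real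
  assumes "\<bar>z\<bar> < 1"
  shows "(\<lambda>l. pochhammer a l / fact l * z ^ l) sums (1 - z) powr (- a)"
proof -
  have "(- a gchoose l) * (- z) ^ l = pochhammer a l / fact l * z ^ l" for l
  proof -
    have "(- 1) ^ l * (- z) ^ l = z ^ l"
      unfolding power_mult_distrib [symmetric] by simp
    then show ?thesis
      unfolding gbinomial_pochhammer by (simp add: mult_ac)
  qed
  then show ?thesis
    using gen_binomial_real[of "- z" "- a"] assms by simp
qed

text \<open>The terms with \<open>l < i\<close> vanish. In the others, splitting the Pochhammer
  symbol after \<open>i\<close> factors pulls out \<open>pochhammer a i * z ^ i\<close> and leaves
  the binomial series with parameter \<open>a + i\<close>.\<close>

lemma pochhammer_binomial_series_sums:
  fixes a z :: real
  assumes "\<bar>z\<bar> < 1"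
  shows "(\<lambda>l. fact i * real (l choose i) * (pochhammer a l / fact l * z ^ l)) sums
           ((1 - z) powr (- a) * (pochhammer a i * (z / (1 - z)) ^ i))"
    (is "?f sums ?s")
proof -
  have "?f (l + i) = pochhammer a i * z ^ i * (pochhammer (a + real i) l / fact l * z ^ l)" for l
  proof -
    have "fact i * real (l + i choose i) / fact (l + i) = 1 / fact l"
      by (simp add: binomial_fact field_simps)
    moreover have "pochhammer a (l + i) = pochhammer a i * pochhammer (a + real i) l"
      using pochhammer_product'[of a i l] by (simp add: add.commute)
    ultimately show ?thesis
      by (simp add: power_add field_simps)
  qed
  moreover have "(\<lambda>l. pochhammer a i * z ^ i * (pochhammer (a + real i) l / fact l * z ^ l)) sums
      (pochhammer a i * z ^ i * (1 - z) powr (- (a + real i)))"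
    by (intro sums_mult pochhammer_series_sums assms)
  moreover have "pochhammer a i * z ^ i * (1 - z) powr (- (a + real i)) = ?s"
  proof -
    have "(1 - z) powr (- (a + real i)) = (1 - z) powr (- a) / (1 - z) ^ i"
      using assms powr_diff[of "1 - z" "- a" "real i"] by (simp add: powr_realpow)
    then show ?thesis
      by (simp add: power_divide)
  qed
  ultimately have "(\<lambda>l. ?f (l + i)) sums ?s"
    by (simp only:)
  moreover have "(\<Sum>l<i. ?f l) = 0"
    by (intro sum.neutral) (simp add: binomial_eq_0)
  ultimately show ?thesis
    using sums_iff_shift[of ?f i ?s] by (simp only: add_0_right)
qed

text \<open>Combining the previous series with weights \<open>Stirling n i\<close> turns the falling
  factorials into \<open>l ^ n\<close>. At \<open>a = \<gamma>\<close>, \<open>z = \<alpha>\<close>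
  the finite sum is the one in \<open>t_coeff\<close>.\<close>

lemma power_pochhammer_series_sums:
  fixes a z :: real
  assumes "\<bar>z\<bar> < 1"
  shows "(\<lambda>l. real l ^ n * (pochhammer a l / fact l * z ^ l)) sums
     ((1 - z) powr (- a) * (\<Sum>i\<le>n. real (Stirling n i) * pochhammer a i * (z / (1 - z)) ^ i))"
proof -
  have "(\<lambda>l. \<Sum>i\<le>n. real (Stirling n i) *
            (fact i * real (l choose i) * (pochhammer a l / fact l * z ^ l))) sums
        (\<Sum>i\<le>n. real (Stirling n i) *
            ((1 - z) powr (- a) * (pochhammer a i * (z / (1 - z)) ^ i)))"
    by (intro sums_sum sums_mult pochhammer_binomial_series_sums assms)
  moreover have "real l ^ n = (\<Sum>i\<le>n. real (Stirling n i) * (fact i * real (l choose i)))" for l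
    using arg_cong[OF power_eq_sum_Stirling_binomial[of l n], of real] by simp
  ultimately show ?thesis
    by (simp add: sum_distrib_left sum_distrib_right mult_ac)
qed

section \<open>Bernoulli inequalities and bounds for Gamma quotients\<close>

lemma one_plus_powr_less:
  fixes x s :: real
  assumes "0 < x" "0 < s" "s < 1"
  shows "(1 + x) powr s < 1 + s * x"
proof -
  \<comment> \<open>\<open>c\<close> is the mean of \<open>1 + x\<close> and 1 with weights
    \<open>s\<close> and \<open>1 - s\<close>. After division by \<open>c\<close> the tangent bounds
    \<open>ln y \<le> y - 1\<close> at the two points therefore add up to 0; the one at
    \<open>1 / c\<close> is strict since \<open>c > 1\<close>.\<close>
  define c where "c = 1 + s * x"
  have c: "c > 1" using assms by (simp add: c_def)
  have "ln ((1 + x) / c) \<le> (1 + x) / c - 1"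
    using assms c by (intro ln_le_minus_one) auto
  then have "s * ln ((1 + x) / c) \<le> s * ((1 + x) / c - 1)"
    using assms by (intro mult_left_mono) auto
  moreover have "(1 - s) * ln (1 / c) < (1 - s) * (1 / c - 1)"
  proof -
    have "ln (1 / c) < 1 / c - 1"
      using c ln_eq_minus_one[of "1 / c"] ln_le_minus_one[of "1 / c"] by fastforce
    then show ?thesis using assms by simp
  qed
  moreover have "s * ((1 + x) / c - 1) + (1 - s) * (1 / c - 1) = 0"
  proof -
    have "s * ((1 + x) / c - 1) + (1 - s) * (1 / c - 1) = (1 + s * x) / c - 1"
      by (simp add: algebra_simps add_divide_distrib diff_divide_distrib)
    then show ?thesis using c by (simp flip: c_def)
  qed
  moreover have "s * ln ((1 + x) / c) + (1 - s) * ln (1 / c) = s * ln (1 + x) - ln c"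
    using c assms by (simp add: ln_div algebra_simps)
  ultimately have "s * ln (1 + x) < ln c" by linarith
  then have "exp (s * ln (1 + x)) < c"
    using c exp_less_mono[of "s * ln (1 + x)" "ln c"] by simp
  then show ?thesis
    using assms by (simp add: powr_def c_def)
qed

lemma one_plus_powr_ge:
  fixes x s :: real
  assumes "0 \<le> x" "s \<le> 0"
  shows "1 + s * x \<le> (1 + x) powr s"
proof -
  have "s * x \<le> s * ln (1 + x)"
    using assms ln_add_one_self_le_self[of x] by (intro mult_left_mono_neg) auto
  then have "1 + s * x \<le> exp (s * ln (1 + x))"
    using exp_ge_add_one_self[of "s * ln (1 + x)"] by linarith
  then show ?thesis
    using assms by (simp add: powr_def)
qed

text \<open>Log-convexity on the interval from \<open>x\<close> to \<open>x + 1\<close>, whose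
  endpoint values differ by the factor \<open>x\<close>.\<close>

lemma Gamma_real_add_le:
  fixes x t :: real
  assumes "x > 0" "0 \<le> t" "t \<le> 1"
  shows "Gamma (x + t) \<le> x powr t * Gamma x"
proof -
  have "ln (Gamma ((1 - t) *\<^sub>R x + t *\<^sub>R (x + 1))) \<le> (1 - t) * ln (Gamma x) + t * ln (Gamma (x + 1))"
    using convex_onD[OF log_convex_Gamma_real, of t x "x + 1"] assms by simp
  moreover have "(1 - t) *\<^sub>R x + t *\<^sub>R (x + 1) = x + t"
    by (simp add: algebra_simps)
  moreover have "Gamma (x + 1) = x * Gamma x"
    using assms by (intro Gamma_plus1) (auto elim!: nonpos_Ints_cases)
  ultimately have "ln (Gamma (x + t)) \<le> t * ln x + ln (Gamma x)"
    using assms by (simp add: ln_mult_pos algebra_simps)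
  also have "\<dots> = ln (x powr t * Gamma x)"
    using assms by (simp add: ln_mult_pos ln_powr)
  finally show ?thesis
    using assms by (subst (asm) ln_le_cancel_iff) (auto intro: add_pos_nonneg)
qed

text \<open>Log-convexity between \<open>x\<close> and \<open>x + 1\<close> would give only a weak
  inequality. Applying it between \<open>x + 1\<close> and \<open>x + 2\<close> and returning by the
  functional equation leaves a gap, which the strict Bernoulli inequality supplies.\<close>

lemma Gamma_real_add_less:
  fixes x s :: real
  assumes "x > 0" "0 < s" "s < 1"
  shows "Gamma (x + s) < x powr (s - 1) * Gamma (x + 1)"
proof -
  have "(x + s) * Gamma (x + s) = Gamma (x + s + 1)"
    using assms by (intro Gamma_plus1 [symmetric]) (auto elim!: nonpos_Ints_cases)
  also have "\<dots> \<le> (x + 1) powr s * Gamma (x + 1)"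
    using Gamma_real_add_le[of "x + 1" s] assms by (simp add: add_ac)
  also have "(x + 1) powr s = x powr s * (1 + 1 / x) powr s"
  proof -
    have "x + 1 = x * (1 + 1 / x)"
      using assms by (simp add: distrib_left)
    then show ?thesis using assms powr_mult[of x "1 + 1 / x" s] by simp
  qed
  also have "\<dots> * Gamma (x + 1) < x powr s * (1 + s * (1 / x)) * Gamma (x + 1)"
    using assms one_plus_powr_less[of "1 / x" s]
    by (intro mult_strict_right_mono mult_strict_left_mono) auto
  also have "\<dots> = (x + s) * (x powr (s - 1) * Gamma (x + 1))"
    using assms by (simp add: powr_diff field_simps)
  finally show ?thesis
    using assms by simp
qed

text \<open>Log-convexity starting at \<open>x + s\<close> with step \<open>1 - s\<close> bounds the
  quotient below by \<open>(x + s) powr (s - 1)\<close>, and Bernoulli with exponent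
  \<open>s - 1\<close> bounds this power. Strictness comes from replacing the resulting
  \<open>(1 - s) * s\<close> by \<open>1 - s\<close>.\<close>

lemma Gamma_real_add_greater:
  fixes x s :: real
  assumes "x > 0" "0 < s" "s < 1"
  shows "(x powr (s - 1) - (1 - s) * x powr (s - 2)) * Gamma (x + 1) < Gamma (x + s)"
proof -
  have "x powr (s - 1) - (1 - s) * x powr (s - 2) = x powr (s - 1) * (1 - (1 - s) / x)"
  proof -
    have "x powr (s - 2) = x powr (s - 1) / x"
      using assms powr_diff[of x "s - 1" 1] by simp
    then show ?thesis by (simp add: algebra_simps)
  qed
  also have "\<dots> < x powr (s - 1) * (1 + (s - 1) * (s / x))"
  proof -
    have "(1 - s) * s < (1 - s) * 1"
      using assms by (intro mult_strict_left_mono) auto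
    then have "(1 - s) * s / x < (1 - s) / x"
      using assms by (intro divide_strict_right_mono) auto
    then have "1 - (1 - s) / x < 1 + (s - 1) * (s / x)"
      by (simp add: algebra_simps diff_divide_distrib)
    then show ?thesis using assms by simp
  qed
  also have "\<dots> \<le> x powr (s - 1) * (1 + s / x) powr (s - 1)"
    using assms by (intro mult_left_mono one_plus_powr_ge) auto
  also have "\<dots> = (x + s) powr (s - 1)"
  proof -
    have "x + s = x * (1 + s / x)"
      using assms by (simp add: distrib_left)
    then show ?thesis using assms powr_mult[of x "1 + s / x" "s - 1"] by simp
  qed
  finally have "(x powr (s - 1) - (1 - s) * x powr (s - 2)) * Gamma (x + 1)
      < (x + s) powr (s - 1) * Gamma (x + 1)"
    using assms by simp
  also have "\<dots> \<le> (x + s) powr (s - 1) * ((x + s) powr (1 - s) * Gamma (x + s))"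
    using Gamma_real_add_le[of "x + s" "1 - s"] assms by (intro mult_left_mono) auto
  also have "\<dots> = Gamma (x + s)"
    using assms by (simp flip: mult.assoc powr_add)
  finally show ?thesis .
qed

section \<open>Convergence of the polylogarithm series\<close>

lemma summable_power_times_geometric:
  fixes z :: real
  assumes "\<bar>z\<bar> < 1"
  shows "summable (\<lambda>l. real l ^ n * z ^ l)"
  \<comment> \<open>At \<open>a = 1\<close> the coefficient \<open>pochhammer a l / fact l\<close>
    equals 1.\<close>
  using sums_summable[OF power_pochhammer_series_sums[OF assms, of n 1]]
  by (simp add: pochhammer_fact [symmetric])

lemma polylog_sums:
  fixes z s :: real
  assumes "\<bar>z\<bar> < 1"
  shows "(\<lambda>l. real (Suc l) powr (- s) * z ^ Suc l) sums polylog s z"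
proof -
  obtain n :: nat where n: "- s \<le> real n"
    using real_arch_simple by blast
  have "summable (\<lambda>l. real l ^ n * \<bar>z\<bar> ^ l)"
    using assms by (intro summable_power_times_geometric) auto
  then have "summable (\<lambda>l. real (Suc l) ^ n * \<bar>z\<bar> ^ Suc l)"
    by (subst summable_Suc_iff)
  then have "summable (\<lambda>l. real (Suc l) powr (- s) * z ^ Suc l)"
  proof (rule summable_comparison_test[rotated], intro exI allI impI)
    fix l
    have "real (Suc l) powr (- s) \<le> real (Suc l) ^ n"
      using n powr_mono[of "- s" "real n" "real (Suc l)"] by (simp add: powr_realpow)
    then show "norm (real (Suc l) powr (- s) * z ^ Suc l) \<le> real (Suc l) ^ n * \<bar>z\<bar> ^ Suc l"
      unfolding real_norm_def abs_mult power_abs by (intro mult_right_mono) auto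
  qed
  then show ?thesis
    by (simp add: summable_sums polylog_def powr_minus field_simps)
qed

section \<open>Termwise comparison of the coefficient series with polylogarithms\<close>

lemma sums_strict_less:
  fixes f g :: "nat \<Rightarrow> real"
  assumes "f sums a" "g sums b" "\<And>l. f l < g l"
  shows "a < b"
proof -
  have "(\<lambda>l. g l - f l) sums (b - a)"
    using assms by (intro sums_diff)
  then have "0 < b - a"
    using suminf_pos[of "\<lambda>l. g l - f l"] assms(3) by (simp add: sums_iff)
  then show ?thesis by simp
qed

theorem proposition4p3:
  fixes \<alpha> \<gamma> :: real and n :: nat
  assumes "0 < \<gamma>" "\<gamma> < 1" and "0 < \<alpha>" "\<alpha> < 1"
  shows "(n \<ge> 1 \<longrightarrow>
            \<bar>t_coeff n \<alpha> \<gamma>\<bar> <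
              (1 - \<alpha>) powr \<gamma> * (\<gamma> powi (- int n) / Gamma \<gamma>) *
              polylog (- real n - \<gamma> + 1) \<alpha>)
       \<and> \<bar>t_coeff n \<alpha> \<gamma>\<bar> >
            (1 - \<alpha>) powr \<gamma> * (\<gamma> powi (- int n) / Gamma \<gamma>) *
            (polylog (- real n - \<gamma> + 1) \<alpha> - (1 - \<gamma>) * polylog (- real n - \<gamma> + 2) \<alpha>)"
proof -
  define S where "S = (\<Sum>i\<le>n. real (Stirling n i) * pochhammer \<gamma> i * (\<alpha> / (1 - \<alpha>)) ^ i)"
  define K where "K = (1 - \<alpha>) powr \<gamma> * (\<gamma> powi (- int n) / Gamma \<gamma>)"
  \<comment> \<open>\<open>M\<close> is what remains of the modulus of \<open>t_coeff\<close> after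
    division by the prefactor \<open>K\<close> common to both bounds, and it is the sum of the
    series \<open>f\<close>.\<close>
  define M where "M = Gamma \<gamma> * ((1 - \<alpha>) powr (- \<gamma>) * S)"
  define f where "f l = Gamma \<gamma> * (real l ^ n * (pochhammer \<gamma> l / fact l * \<alpha> ^ l))" for l
  have Gamma_pos: "Gamma \<gamma> > 0" and K_pos: "K > 0"
    using assms by (auto simp: K_def)
  then have Gamma_nz: "Gamma \<gamma> \<noteq> 0"
    by simp
  have "S \<ge> 0"
    unfolding S_def using assms by (intro sum_nonneg mult_nonneg_nonneg) (auto simp: pochhammer_nonneg)
  then have "\<bar>t_coeff n \<alpha> \<gamma>\<bar> = \<gamma> powi (- int n) * S"
    using assms by (simp add: t_coeff_def S_def abs_mult atLeast0AtMost power_int_abs)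
  also have "\<dots> = K * M"
    using assms Gamma_nz by (simp add: K_def M_def powr_minus field_simps)
  finally have t_eq: "\<bar>t_coeff n \<alpha> \<gamma>\<bar> = K * M" .

  have "f sums M"
    unfolding f_def M_def S_def using assms
    by (intro sums_mult power_pochhammer_series_sums) auto
  \<comment> \<open>The polylogarithm starts at \<open>l = 1\<close>, so the term \<open>f 0\<close>
    is split off and treated separately in each bound.\<close>
  then have f_sums: "(\<lambda>l. f (Suc l)) sums (M - f 0)"
    by (subst sums_Suc_iff) simp
  have f_eq: "f l = Gamma (real l + \<gamma>) / Gamma (real l + 1) * (real l ^ n * \<alpha> ^ l)" for l
  proof -
    have "\<gamma> \<notin> \<int>\<^sub>\<le>\<^sub>0"
      using assms by (auto elim!: nonpos_Ints_cases)
    then have "pochhammer \<gamma> l = Gamma (real l + \<gamma>) / Gamma \<gamma>"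
      by (simp add: pochhammer_Gamma add.commute)
    then show ?thesis
      using Gamma_nz Gamma_fact[of l, where 'a = real] by (simp add: f_def add.commute)
  qed
  have weight_pos: "real (Suc l) ^ n * \<alpha> ^ Suc l > 0" for l
    using assms by (intro mult_pos_pos) auto
  \<comment> \<open>The positive weight \<open>l ^ n * \<alpha> ^ l\<close> is common to
    \<open>f\<close> and to both polylogarithms (\<open>c = 1\<close> and \<open>c = 2\<close>), so
    only the Gamma quotient and powers of \<open>l\<close> have to be compared.\<close>
  have powr_eq: "real (Suc l) powr (- (- real n - \<gamma> + c)) * \<alpha> ^ Suc l
      = real (Suc l) powr (\<gamma> - c) * (real (Suc l) ^ n * \<alpha> ^ Suc l)" for l c
  proof -
    have "- (- real n - \<gamma> + c) = \<gamma> - c + real n"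
      by simp
    then show ?thesis
      by (simp only: powr_add) (simp add: powr_realpow)
  qed
  have L_sums: "(\<lambda>l. real (Suc l) powr (\<gamma> - c) * (real (Suc l) ^ n * \<alpha> ^ Suc l)) sums
      polylog (- real n - \<gamma> + c) \<alpha>" for c
    using polylog_sums[of \<alpha> "- real n - \<gamma> + c"] assms unfolding powr_eq by simp

  have "M < polylog (- real n - \<gamma> + 1) \<alpha>" if "n \<ge> 1"
  proof -
    have "f (Suc l) < real (Suc l) powr (\<gamma> - 1) * (real (Suc l) ^ n * \<alpha> ^ Suc l)" for l
      unfolding f_eq using Gamma_real_add_less[of "real (Suc l)" \<gamma>] assms
      by (intro mult_strict_right_mono weight_pos) (simp add: pos_divide_less_eq)
    then have "M - f 0 < polylog (- real n - \<gamma> + 1) \<alpha>"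
      by (rule sums_strict_less[OF f_sums L_sums])
    \<comment> \<open>For \<open>n \<ge> 1\<close> the term \<open>f 0\<close> is 0. For
      \<open>n = 0\<close> it is \<open>Gamma \<gamma>\<close>, and the upper bound then fails for
      small \<alpha>, where the polylogarithm tends to 0.\<close>
    then show ?thesis using that by (simp add: f_def power_0_left)
  qed
  moreover have "polylog (- real n - \<gamma> + 1) \<alpha> - (1 - \<gamma>) * polylog (- real n - \<gamma> + 2) \<alpha> < M"
  proof -
    have "(\<lambda>l. real (Suc l) powr (\<gamma> - 1) * (real (Suc l) ^ n * \<alpha> ^ Suc l)
          - (1 - \<gamma>) * (real (Suc l) powr (\<gamma> - 2) * (real (Suc l) ^ n * \<alpha> ^ Suc l))) sums
        (polylog (- real n - \<gamma> + 1) \<alpha> - (1 - \<gamma>) * polylog (- real n - \<gamma> + 2) \<alpha>)"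
      by (intro sums_diff sums_mult L_sums)
    moreover have "real (Suc l) powr (\<gamma> - 1) * (real (Suc l) ^ n * \<alpha> ^ Suc l)
          - (1 - \<gamma>) * (real (Suc l) powr (\<gamma> - 2) * (real (Suc l) ^ n * \<alpha> ^ Suc l))
        < f (Suc l)" for l
    proof -
      have "real (Suc l) powr (\<gamma> - 1) - (1 - \<gamma>) * real (Suc l) powr (\<gamma> - 2)
          < Gamma (real (Suc l) + \<gamma>) / Gamma (real (Suc l) + 1)"
        using Gamma_real_add_greater[of "real (Suc l)" \<gamma>] assms by (simp add: pos_less_divide_eq)
      from mult_strict_right_mono[OF this weight_pos[of l]] show ?thesis
        unfolding f_eq by (simp only: left_diff_distrib mult.assoc)
    qed
    ultimately have "polylog (- real n - \<gamma> + 1) \<alpha> - (1 - \<gamma>) * polylog (- real n - \<gamma> + 2) \<alpha> < M - f 0"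
      by (rule sums_strict_less[OF _ f_sums])
    \<comment> \<open>Dropping a nonnegative term only helps the lower bound, which thus holds for
      \<open>n = 0\<close> as well.\<close>
    moreover have "f 0 \<ge> 0"
      using Gamma_pos by (simp add: f_def)
    ultimately show ?thesis by simp
  qed
  ultimately show ?thesis
    unfolding t_eq K_def [symmetric] using K_pos by simp
qed

end
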